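(* Let $R$ be a Noetherian commutative ring of prime characteristic $p>0$, let $I$ be a non-zero proper ideal of $R$, and let $\mathfrak{a}_\bullet$ be an $(I,p)$-admissible filtration of ideals in $R$. Then $\mathcal{C}^I(\mathfrak{a}_\bullet)=\lim_{e\to\infty}\frac{\nu^I_{\mathfrak{a}_\bullet}(p^e)}{p^e}$ exists (as a finite real number).
   Context: A filtration of ideals in $R$ is a sequence $\mathfrak{a}_\bullet=\{\mathfrak{a}_i\}_{i\ge 0}$ of ideals with $\mathfrak{a}_0=R$, $\mathfrak{a}_{i+1}\subseteq\mathfrak{a}_i$, and $\mathfrak{a}_i\mathfrak{a}_j\subseteq \mathfrak{a}_{i+j}$ for all $i,j\ge 0$. For an ideal $J$, $J^{[p^e]}$ is the ideal generated by all $f^{p^e}$, $f\in J$. A filtration $\mathfrak{a}_\bullet$ is $(I,p)$-admissible if (i) $\mathfrak{a}_k\subseteq I$ for some $k$, and (ii) there exist integers $h>0$ and $c$ such that $\mathfrak{a}_{(h+m)p^e+c}\subseteq\mathfrak{a}_{m+1}^{[p^e]}$ for all integers $m,e\ge 0$ (with the convention $\mathfrak{a}_i=R$ for $i<0$). For $e\ge 0$, $\nu_{\mathfrak{a}_\bullet}^I(p^e)=\sup\{r\in\mathbb{Z}_{\ge 0}:\mathfrak{a}_r\not\subseteq I^{[p^e]}\}$. *)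

theory Defs
  imports
    "HOL-Algebra.Ideal_Product"
    "HOL-Algebra.Ring_Divisibility"
    "HOL-Algebra.Multiplicative_Group"
    "HOL-Library.Extended_Real"
    "HOL-Computational_Algebra.Primes"
begin

text \<open>The value is \<open>0\<close> if \<open>\<one>\<close> has infinite additive order.\<close>

definition ring_char :: "('a, 'b) ring_scheme \<Rightarrow> nat" where
  "ring_char R = group.ord (add_monoid R) \<one>\<^bsub>R\<^esub>"

definition frob_power :: "('a, 'b) ring_scheme \<Rightarrow> nat \<Rightarrow> 'a set \<Rightarrow> nat \<Rightarrow> 'a set" where
  "frob_power R p J e = genideal R ((\<lambda>f. f [^]\<^bsub>R\<^esub> (p ^ e)) ` J)"

definition ideal_filtration :: "('a, 'b) ring_scheme \<Rightarrow> (nat \<Rightarrow> 'a set) \<Rightarrow> bool" where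
  "ideal_filtration R \<aa> \<longleftrightarrow>
     (\<forall>i. ideal (\<aa> i) R) \<and>
     \<aa> 0 = carrier R \<and>
     (\<forall>i. \<aa> (Suc i) \<subseteq> \<aa> i) \<and>
     (\<forall>i j. \<aa> i \<cdot>\<^bsub>R\<^esub> \<aa> j \<subseteq> \<aa> (i + j))"

definition filtration_int :: "('a, 'b) ring_scheme \<Rightarrow> (nat \<Rightarrow> 'a set) \<Rightarrow> int \<Rightarrow> 'a set" where
  "filtration_int R \<aa> i = (if i < 0 then carrier R else \<aa> (nat i))"

definition admissible ::
    "('a, 'b) ring_scheme \<Rightarrow> 'a set \<Rightarrow> nat \<Rightarrow> (nat \<Rightarrow> 'a set) \<Rightarrow> bool" where
  "admissible R I p \<aa> \<longleftrightarrow>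
     (\<exists>k. \<aa> k \<subseteq> I) \<and>
     (\<exists>(h::int) (c::int). h > 0 \<and>
        (\<forall>m e :: nat.
           filtration_int R \<aa> ((h + int m) * int p ^ e + c) \<subseteq> frob_power R p (\<aa> (m + 1)) e))"

text \<open>The supremum is taken in the extended naturals, so that an unbounded set of
  indices yields \<open>\<infinity>\<close> instead of an arbitrary natural number.\<close>

definition nu ::
    "('a, 'b) ring_scheme \<Rightarrow> nat \<Rightarrow> 'a set \<Rightarrow> (nat \<Rightarrow> 'a set) \<Rightarrow> nat \<Rightarrow> enat" where
  "nu R p I \<aa> e = Sup {enat r | r. \<not> \<aa> r \<subseteq> frob_power R p I e}"

definition nu_quotient ::
    "('a, 'b) ring_scheme \<Rightarrow> nat \<Rightarrow> 'a set \<Rightarrow> (nat \<Rightarrow> 'a set) \<Rightarrow> nat \<Rightarrow> ereal" where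
  "nu_quotient R p I \<aa> e = ereal_of_enat (nu R p I \<aa> e) / ereal (real p ^ e)"

text \<open>Since \<^term>\<open>lim\<close> is arbitrary on divergent sequences, this is only meaningful
  together with a proof that the sequence converges to it.\<close>

definition threshold ::
    "('a, 'b) ring_scheme \<Rightarrow> nat \<Rightarrow> 'a set \<Rightarrow> (nat \<Rightarrow> 'a set) \<Rightarrow> ereal" where
  "threshold R p I \<aa> = lim (nu_quotient R p I \<aa>)"

end

theory Submission
  imports Defs
begin

text \<open>If \<open>\<nu>\<^sub>e\<close> denotes the index for \<open>p\<^sup>e\<close>, then \<open>\<aa>\<close> at \<open>\<nu>\<^sub>e + 1\<close> lies in the \<open>p\<^sup>e\<close>-th Frobenius
  power of \<open>I\<close>. Admissibility with \<open>m = \<nu>\<^sub>e\<close> and a single Frobenius step then gives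
  \<open>\<nu>\<^sub>e\<^sub>+\<^sub>1 < (h + \<nu>\<^sub>e) p + c\<close>. For \<open>K = h p + \<bar>c\<bar>\<close> the sequence \<open>(\<nu>\<^sub>e + K) / p\<^sup>e\<close> is therefore
  decreasing and nonnegative, hence convergent, and it differs from \<open>\<nu>\<^sub>e / p\<^sup>e\<close> by a null
  sequence.\<close>

section \<open>Additivity of the Frobenius map in prime characteristic\<close>

lemma (in cring) binomial_expansion:
  assumes x: "x \<in> carrier R" and y: "y \<in> carrier R"
  shows "(x \<oplus> y) [^] (n::nat) = (\<Oplus>k\<in>{..n}. [(n choose k)] \<cdot> (x [^] k \<otimes> y [^] (n - k)))"
proof (induction n)
  case 0
  then show ?case by (simp add: add.nat_pow_eone)
next
  case (Suc n)
  define T where "T n k = [(n choose k)] \<cdot> (x [^] k \<otimes> y [^] (n - k))" for n k :: nat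
  have T: "T n k \<in> carrier R" for n k
    using x y by (simp add: T_def)
  \<comment> \<open>Pascal's rule, applied termwise.\<close>
  have step: "T (Suc n) (Suc k) = x \<otimes> T n k \<oplus> y \<otimes> T n (Suc k)" if "k \<le> n" for k
  proof -
    have 1: "x \<otimes> T n k = [(n choose k)] \<cdot> (x [^] Suc k \<otimes> y [^] (n - k))"
      using x y by (simp add: T_def add_pow_rdistr m_ac)
    have 2: "y \<otimes> T n (Suc k) = [(n choose Suc k)] \<cdot> (x [^] Suc k \<otimes> y [^] (n - k))"
    \<comment> \<open>At \<open>k = n\<close> the subtraction \<open>n - Suc k\<close> truncates,
      but the coefficient \<open>n choose Suc k\<close> vanishes there.\<close>
    proof (cases "k = n")
      case True
      then show ?thesis using x y by (simp add: T_def binomial_eq_0)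
    next
      case False
      then have "n - k = Suc (n - Suc k)" using that by simp
      then show ?thesis using x y by (simp add: T_def add_pow_rdistr m_ac)
    qed
    show ?thesis
      unfolding 1 2 using x y by (simp add: T_def add.nat_pow_mult)
  qed
  have T0: "T (Suc n) 0 = y \<otimes> T n 0"
    using x y by (simp add: T_def m_ac)
  have top: "T n (Suc n) = \<zero>"
    by (simp add: T_def binomial_eq_0)
  let ?S = "\<Oplus>k\<in>{..n}. T n k"
  have S: "?S \<in> carrier R" using T by simp
  have "(\<Oplus>k\<in>{..Suc n}. T (Suc n) k) = (\<Oplus>k\<in>{..n}. T (Suc n) (Suc k)) \<oplus> T (Suc n) 0"
    by (rule finsum_Suc2) (use T in auto)
  also have "(\<Oplus>k\<in>{..n}. T (Suc n) (Suc k)) = (\<Oplus>k\<in>{..n}. x \<otimes> T n k \<oplus> y \<otimes> T n (Suc k))"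
    by (rule add.finprod_cong') (use step T x y in auto)
  also have "\<dots> = (\<Oplus>k\<in>{..n}. x \<otimes> T n k) \<oplus> (\<Oplus>k\<in>{..n}. y \<otimes> T n (Suc k))"
    by (rule finsum_addf) (use T x y in auto)
  also have "\<dots> \<oplus> T (Suc n) 0
      = (\<Oplus>k\<in>{..n}. x \<otimes> T n k) \<oplus> ((\<Oplus>k\<in>{..n}. y \<otimes> T n (Suc k)) \<oplus> y \<otimes> T n 0)"
    unfolding T0 using T x y by (simp add: a_assoc Pi_def)
  \<comment> \<open>Undoing the index shift overshoots by the term at \<open>Suc n\<close>, which is
    zero by \<open>top\<close>.\<close>
  also have "(\<Oplus>k\<in>{..n}. y \<otimes> T n (Suc k)) \<oplus> y \<otimes> T n 0 = (\<Oplus>k\<in>{..Suc n}. y \<otimes> T n k)"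
    by (rule finsum_Suc2[symmetric]) (use T y in auto)
  also have "\<dots> = y \<otimes> T n (Suc n) \<oplus> (\<Oplus>k\<in>{..n}. y \<otimes> T n k)"
    by (rule finsum_Suc) (use T y in auto)
  also have "\<dots> = (\<Oplus>k\<in>{..n}. y \<otimes> T n k)"
    using T y by (simp add: top Pi_def)
  also have "(\<Oplus>k\<in>{..n}. x \<otimes> T n k) = x \<otimes> ?S"
    by (rule finsum_rdistr[symmetric]) (use T x in auto)
  also have "(\<Oplus>k\<in>{..n}. y \<otimes> T n k) = y \<otimes> ?S"
    by (rule finsum_rdistr[symmetric]) (use T y in auto)
  also have "x \<otimes> ?S \<oplus> y \<otimes> ?S = ?S \<otimes> (x \<oplus> y)"
    using S x y by (simp add: l_distr m_comm)
  finally show ?case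
    using Suc.IH by (simp add: T_def)
qed

text \<open>Taking \<open>n\<close>-fold sums is multiplication by
  \<open>[n] \<cdot> \<one>\<close>, and the characteristic is the additive order of
  \<open>\<one>\<close>.\<close>

lemma (in cring) add_pow_ring_char:
  assumes "x \<in> carrier R" and "ring_char R dvd n"
  shows "[n] \<cdot> x = \<zero>"
proof -
  have "[n] \<cdot> \<one> = \<zero>"
    using assms(2) group.pow_eq_id[OF a_group, of \<one> n]
    by (simp add: ring_char_def add_pow_def)
  then show ?thesis
    using assms(1) add_pow_ldistr[of \<one> x n] by simp
qed

text \<open>A prime divides its inner binomial coefficients, so only the two extreme terms of the
  expansion survive.\<close>

lemma (in cring) frobenius_add:
  assumes x: "x \<in> carrier R" and y: "y \<in> carrier R"
    and p: "prime p" and char: "ring_char R = p"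
  shows "(x \<oplus> y) [^] p = x [^] p \<oplus> y [^] p"
proof -
  obtain q where q: "p = Suc q" "q > 0"
    using prime_gt_1_nat[OF p] by (cases p) auto
  let ?T = "\<lambda>k. [(p choose k)] \<cdot> (x [^] k \<otimes> y [^] (p - k))"
  have T: "?T k \<in> carrier R" for k using x y by simp
  have zero: "?T (Suc k) = \<zero>" if "k < q" for k
  proof (rule add_pow_ring_char)
    show "ring_char R dvd p choose Suc k"
      unfolding char by (rule dvd_choose_prime[OF _ _ _ p]) (use that q in auto)
  qed (use x y in simp)
  have "(x \<oplus> y) [^] p = (\<Oplus>k\<in>{..Suc q}. ?T k)"
    using binomial_expansion[OF x y, of p] q by simp
  also have "\<dots> = ?T (Suc q) \<oplus> (\<Oplus>k\<in>{..q}. ?T k)"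
    by (rule finsum_Suc) (use T in auto)
  also have "(\<Oplus>k\<in>{..q}. ?T k) = (\<Oplus>k\<in>{..q-1}. ?T (Suc k)) \<oplus> ?T 0"
    using finsum_Suc2[of ?T "q - 1"] T q(2) by simp
  also have "(\<Oplus>k\<in>{..q-1}. ?T (Suc k)) = (\<Oplus>k\<in>{..q-1}. \<zero>)"
    by (rule add.finprod_cong') (use zero q in auto)
  finally show ?thesis
    using x y q by simp
qed

text \<open>Closure under sums is additivity of Frobenius. Since the set is an ideal, whether a
  generated ideal lies in it can be tested on generators.\<close>

lemma (in cring) frobenius_preimage_ideal:
  assumes J: "ideal J R" and p: "prime p" and char: "ring_char R = p"
  shows "ideal {f \<in> carrier R. f [^] p \<in> J} R"
proof (rule idealI)
  interpret J: ideal J R by fact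
  have p0: "p \<noteq> 0" using p by auto
  have mult: "a \<otimes> x \<in> {f \<in> carrier R. f [^] p \<in> J}"
    if "a \<in> {f \<in> carrier R. f [^] p \<in> J}" "x \<in> carrier R" for a x
    using that by (auto simp: nat_pow_distrib intro: J.I_r_closed)
  show "a \<otimes> x \<in> {f \<in> carrier R. f [^] p \<in> J}"
    if "a \<in> {f \<in> carrier R. f [^] p \<in> J}" "x \<in> carrier R" for a x
    by (fact mult[OF that])
  show "x \<otimes> a \<in> {f \<in> carrier R. f [^] p \<in> J}"
    if "a \<in> {f \<in> carrier R. f [^] p \<in> J}" "x \<in> carrier R" for a x
    using mult[OF that] that by (simp add: m_comm)
  show "subgroup {f \<in> carrier R. f [^] p \<in> J} (add_monoid R)"
  proof (rule add.subgroupI)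
    show "{f \<in> carrier R. f [^] p \<in> J} \<subseteq> carrier R"
      by auto
    show "{f \<in> carrier R. f [^] p \<in> J} \<noteq> {}"
      using p0 by (auto intro!: exI[of _ \<zero>] simp: nat_pow_zero)
    \<comment> \<open>Negation is multiplication by \<open>\<ominus> \<one>\<close>, which avoids
      separating \<open>p = 2\<close> from odd \<open>p\<close>.\<close>
    show "\<ominus> a \<in> {f \<in> carrier R. f [^] p \<in> J}"
      if "a \<in> {f \<in> carrier R. f [^] p \<in> J}" for a
      using mult[OF that, of "\<ominus> \<one>"] that by (simp add: r_minus)
    show "a \<oplus> b \<in> {f \<in> carrier R. f [^] p \<in> J}"
      if "a \<in> {f \<in> carrier R. f [^] p \<in> J}" "b \<in> {f \<in> carrier R. f [^] p \<in> J}" for a b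
      using that by (auto simp: frobenius_add[OF _ _ p char])
  qed
qed (rule ring_axioms)

section \<open>Frobenius powers of ideals\<close>

lemma (in cring) frob_power_ideal:
  assumes "J \<subseteq> carrier R"
  shows "ideal (frob_power R p J e) R"
  unfolding frob_power_def using assms by (intro genideal_ideal) auto

lemma (in cring) frob_power_subset:
  assumes J: "ideal J R" and p: "p > 0"
  shows "frob_power R p J e \<subseteq> J"
  unfolding frob_power_def
proof (rule genideal_minimal[OF J])
  interpret J: ideal J R by fact
  have "f [^] Suc n \<in> J" if "f \<in> J" for f and n :: nat
    using that by (simp add: J.I_l_closed)
  \<comment> \<open>Positivity of \<open>p\<close> rules out the exponent 0, for which the power
    would be \<open>\<one>\<close>.\<close>
  moreover obtain n where "p ^ e = Suc n"
    using p by (metis gr0_implies_Suc zero_less_power)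
  ultimately show "(\<lambda>f. f [^] (p ^ e)) ` J \<subseteq> J"
    by auto
qed

lemma (in cring) frob_power_0:
  assumes "ideal J R"
  shows "frob_power R p J 0 = J"
proof -
  interpret J: ideal J R by fact
  have "(\<lambda>f. f [^] (1::nat)) ` J = J"
    using J.Icarr by (auto simp: image_iff)
  moreover have "Idl J = J"
    using genideal_minimal[OF assms, of J] genideal_self[of J] J.Icarr by blast
  ultimately show ?thesis
    by (simp add: frob_power_def)
qed

text \<open>Taking Frobenius powers of \<open>I\<close> composes: the elements whose
  \<open>p\<close>-th power lies in the target form an ideal \<open>?K\<close>. It contains the
  \<open>p ^ e\<close>-th powers of elements of \<open>I\<close>, hence the ideal they generate,
  hence \<open>J\<close>.\<close>

lemma (in cring) frob_power_Suc_subset: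
  assumes I: "ideal I R" and p: "prime p" and char: "ring_char R = p"
    and J: "J \<subseteq> frob_power R p I e"
  shows "frob_power R p J 1 \<subseteq> frob_power R p I (Suc e)"
proof -
  interpret I: ideal I R by fact
  let ?K = "{f \<in> carrier R. f [^] p \<in> frob_power R p I (Suc e)}"
  have IS: "I \<subseteq> carrier R" using I.Icarr by auto
  have ideal: "ideal (frob_power R p I (Suc e)) R"
    by (rule frob_power_ideal[OF IS])
  have "(\<lambda>f. f [^] (p ^ Suc e)) ` I \<subseteq> frob_power R p I (Suc e)"
    unfolding frob_power_def using IS by (intro genideal_self) auto
  moreover have "(f [^] (p ^ e)) [^] p = f [^] (p ^ Suc e)" if "f \<in> I" for f
    using that IS by (auto simp: nat_pow_pow mult.commute)
  ultimately have "(\<lambda>f. f [^] (p ^ e)) ` I \<subseteq> ?K"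
    using IS by auto
  then have "frob_power R p I e \<subseteq> ?K"
    unfolding frob_power_def[of R p I e]
    by (intro genideal_minimal frobenius_preimage_ideal ideal p char)
  with J have "(\<lambda>f. f [^] (p ^ 1)) ` J \<subseteq> frob_power R p I (Suc e)"
    by auto
  then show ?thesis
    unfolding frob_power_def[of R p J] by (rule genideal_minimal[OF ideal])
qed

section \<open>Bounds for the index \<open>nu\<close>\<close>

lemma ideal_filtration_antimono:
  assumes "ideal_filtration R \<aa>" and "i \<le> j"
  shows "\<aa> j \<subseteq> \<aa> i"
  using assms lift_Suc_antimono_le[of \<aa> i j] by (simp add: ideal_filtration_def)

text \<open>By monotonicity every index in the supremum is below \<open>k\<close>. Properness forces
  \<open>k > 0\<close>, so the resulting bound \<open>k - 1\<close> is strictly smaller than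
  \<open>k\<close>, even for natural subtraction.\<close>

lemma nu_less:
  assumes filt: "ideal_filtration R \<aa>"
    and proper: "\<not> carrier R \<subseteq> frob_power R p I e"
    and sub: "\<aa> k \<subseteq> frob_power R p I e"
  shows "nu R p I \<aa> e < enat k"
proof -
  have "\<aa> 0 = carrier R" using filt by (simp add: ideal_filtration_def)
  with proper sub have k: "k > 0" by (cases k) auto
  have "nu R p I \<aa> e \<le> enat (k - 1)"
    unfolding nu_def
  proof (rule Sup_least)
    fix z assume "z \<in> {enat r |r. \<not> \<aa> r \<subseteq> frob_power R p I e}"
    then obtain r where z: "z = enat r" and r: "\<not> \<aa> r \<subseteq> frob_power R p I e" by blast
    have "r < k"
      using r sub ideal_filtration_antimono[OF filt, of k r] by (metis not_less subset_trans)
    then show "z \<le> enat (k - 1)" by (simp add: z)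
  qed
  also have "\<dots> < enat k" using k by simp
  finally show ?thesis .
qed

lemma subset_frob_power_of_nu:
  assumes "nu R p I \<aa> e = enat n"
  shows "\<aa> (Suc n) \<subseteq> frob_power R p I e"
proof (rule ccontr)
  assume "\<not> \<aa> (Suc n) \<subseteq> frob_power R p I e"
  then have "enat (Suc n) \<le> nu R p I \<aa> e"
    unfolding nu_def by (intro Sup_upper) auto
  with assms show False by simp
qed

lemma convergent_quotient_of_recurrence:
  fixes N :: "nat \<Rightarrow> nat" and p h c :: real
  assumes p: "p \<ge> 2" and h: "h \<ge> 0"
    and rec: "\<And>e. real (N (Suc e)) \<le> (h + real (N e)) * p + c"
  shows "convergent (\<lambda>e. real (N e) / p ^ e)"
proof -
  \<comment> \<open>One copy of \<open>K\<close> absorbs \<open>h * p + c\<close> from the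
    recurrence and a second is the shift itself; \<open>p \<ge> 2\<close> gives
    \<open>2 * K \<le> K * p\<close>, so the shifted sequence grows by at most a factor
    \<open>p\<close>.\<close>
  define K where "K = h * p + \<bar>c\<bar>"
  have K0: "K \<ge> 0" using p h by (simp add: K_def)
  define y where "y e = (real (N e) + K) / p ^ e" for e
  have "y (Suc e) \<le> y e" for e
  proof -
    have "K * 2 \<le> K * p" using K0 p by (intro mult_left_mono) auto
    then have "real (N (Suc e)) + K \<le> (real (N e) + K) * p"
      using rec[of e] by (simp add: K_def algebra_simps)
    then have "(real (N (Suc e)) + K) / p ^ Suc e \<le> ((real (N e) + K) * p) / p ^ Suc e"
      using p by (intro divide_right_mono) auto
    then show ?thesis using p by (simp add: y_def)
  qed
  then have "decseq y" by (rule decseq_SucI)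
  moreover have "0 \<le> y e" for e using K0 p by (simp add: y_def)
  ultimately obtain L where L: "y \<longlonglongrightarrow> L"
    by (metis decseq_convergent)
  have "(\<lambda>e. K * inverse (p ^ e)) \<longlonglongrightarrow> K * 0"
    using p by (intro tendsto_mult tendsto_const LIMSEQ_inverse_realpow_zero) auto
  from tendsto_diff[OF L this] have "(\<lambda>e. real (N e) / p ^ e) \<longlonglongrightarrow> L"
    by (simp add: y_def field_simps diff_divide_distrib[symmetric])
  then show ?thesis by (rule convergentI)
qed

theorem theorem4p4:
  fixes R :: "('a, 'b) ring_scheme"
    and p :: nat
    and I :: "'a set"
    and \<aa> :: "nat \<Rightarrow> 'a set"
  assumes "cring R"
    and "noetherian_ring R"
    and "prime p"
    and "ring_char R = p"
    and "ideal I R"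
    and "I \<noteq> {\<zero>\<^bsub>R\<^esub>}"
    and "I \<noteq> carrier R"
    and "ideal_filtration R \<aa>"
    and "admissible R I p \<aa>"
  shows "nu_quotient R p I \<aa> \<longlonglongrightarrow> threshold R p I \<aa> \<and> \<bar>threshold R p I \<aa>\<bar> \<noteq> \<infinity>"
proof -
  interpret cring R by fact
  interpret I: ideal I R by fact
  note filt = \<open>ideal_filtration R \<aa>\<close>
  from \<open>admissible R I p \<aa>\<close> obtain k h c where k: "\<aa> k \<subseteq> I" and h: "(h::int) > 0"
    and adm: "\<And>m e. filtration_int R \<aa> ((h + int m) * int p ^ e + c) \<subseteq> frob_power R p (\<aa> (m + 1)) e"
    unfolding admissible_def by blast
  have a_carrier: "\<aa> i \<subseteq> carrier R" for i
    using ideal_filtration_antimono[OF filt, of 0 i] filt by (simp add: ideal_filtration_def)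
  have "\<not> carrier R \<subseteq> I"
    using \<open>I \<noteq> carrier R\<close> I.Icarr by auto
  then have proper: "\<not> carrier R \<subseteq> frob_power R p I e" for e
    \<comment> \<open>Every Frobenius power of \<open>I\<close> stays inside the proper ideal
      \<open>I\<close>.\<close>
    using frob_power_subset[OF \<open>ideal I R\<close> prime_gt_0_nat[OF \<open>prime p\<close>], of e] by blast
  have step: "nu R p I \<aa> (Suc e) < enat (nat ((h + int n) * int p + c))"
    if "nu R p I \<aa> e = enat n" for e n
  proof (rule nu_less[OF filt proper])
    \<comment> \<open>If the integer index is negative, \<open>nat\<close> turns it into 0 while the
      right-hand side is the whole ring, so the inclusion still holds.\<close>
    have "\<aa> (nat ((h + int n) * int p + c)) \<subseteq> filtration_int R \<aa> ((h + int n) * int p ^ 1 + c)"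
      using a_carrier by (simp add: filtration_int_def)
    also have "\<dots> \<subseteq> frob_power R p (\<aa> (n + 1)) 1"
      by (rule adm)
    also have "\<dots> \<subseteq> frob_power R p I (Suc e)"
      using subset_frob_power_of_nu[OF that]
      by (intro frob_power_Suc_subset assms) simp
    finally show "\<aa> (nat ((h + int n) * int p + c)) \<subseteq> frob_power R p I (Suc e)" .
  qed
  have "\<exists>n. nu R p I \<aa> e = enat n" for e
  proof (induction e)
    case 0
    \<comment> \<open>The exponent \<open>p ^ 0\<close> gives back \<open>I\<close> itself, so the
      first admissibility condition starts the induction on finiteness.\<close>
    have "nu R p I \<aa> 0 < enat k"
      using k by (intro nu_less[OF filt proper]) (simp add: frob_power_0[OF \<open>ideal I R\<close>])
    then show ?case by (cases "nu R p I \<aa> 0") auto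
  next
    case (Suc e)
    then obtain n where "nu R p I \<aa> e = enat n" by blast
    from step[OF this] show ?case by (cases "nu R p I \<aa> (Suc e)") auto
  qed
  then obtain N where N: "\<And>e. nu R p I \<aa> e = enat (N e)" by metis
  have "real (N (Suc e)) \<le> (real_of_int h + real (N e)) * real p + real_of_int c" for e
  proof -
    \<comment> \<open>The strict bound in \<open>step\<close> makes the argument of
      \<open>nat\<close> positive, so \<open>nat\<close> loses nothing here.\<close>
    have "int (N (Suc e)) \<le> (h + int (N e)) * int p + c"
      using step[OF N, of e] by (simp add: N)
    then have "real_of_int (int (N (Suc e))) \<le> real_of_int ((h + int (N e)) * int p + c)"
      by (simp only: of_int_le_iff)
    then show ?thesis by simp
  qed
  then have "convergent (\<lambda>e. real (N e) / real p ^ e)"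
    using h prime_ge_2_nat[OF \<open>prime p\<close>] by (intro convergent_quotient_of_recurrence[where h = h and c = c]) auto
  then obtain L where L: "(\<lambda>e. real (N e) / real p ^ e) \<longlonglongrightarrow> L"
    by (auto simp: convergent_def)
  have "nu_quotient R p I \<aa> = (\<lambda>e. ereal (real (N e) / real p ^ e))"
    using prime_gt_0_nat[OF \<open>prime p\<close>] by (simp add: fun_eq_iff nu_quotient_def N)
  then have lim: "nu_quotient R p I \<aa> \<longlonglongrightarrow> ereal L"
    using L by simp
  then have "threshold R p I \<aa> = ereal L"
    unfolding threshold_def by (rule limI)
  with lim show ?thesis by simp
qed

end
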